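(* Let $V \subseteq \mathbb{P}^n$ be a nonempty projective variety. Suppose that $\mathbb{I}(V):\langle x_0x_1 \cdots x_n \rangle = \mathbb{I}(V)$. Let $p = [p_0:\cdots:p_n] \in \mathbb{P}^n$ be a point with $p_0\cdots p_n \neq 0$. Let $<$ be a monomial order on $k[x_0,\ldots,x_n]$ and let $\mathcal{G} = \{ f_1, \dots, f_m \}$ be the reduced Gröbner basis of $\mathbb{I}(V)$ with respect to $<$. Assume that every element of $\mathcal{G}$ has degree $\geq 2$. For each $i =1,\ldots,m$, write $$f_i = X^{\alpha_{1,i}} - a_{2,i}X^{\alpha_{2,i}} - \dots - a_{k_i,i}X^{\alpha_{k_i,i}}$$ with nonzero coefficients $a_{\ell,i} \in k$ and $X^{\alpha_{k_i,i}} < \cdots < X^{\alpha_{1,i}}$, so that $X^{\alpha_{1,i}}$ is the leading term of $f_i$. Let $$J := \langle b_{1,i}X^{\alpha_{1,i}} - b_{\ell,i}X^{\alpha_{\ell,i}} \mid i=1,\ldots,m \text{ and } 1<\ell \leq k_i \rangle,$$ where the nonzero constants $b_{j,i}\in k$ are chosen so that they satisfy the equations $b_{1,i}p^{\alpha_{1,i}} = b_{\ell,i}p^{\alpha_{\ell,i}}$ for all $1 \leq i\leq m$ and $1 < \ell \leq k_i$. If $\mathbb{I}(\mathbb{V}(J)):\langle x_0x_1\cdots x_n\rangle = J$, then $$J=\sqrt{J} = \mathbb{I}(\psi(V,p)).$$ In particular, under the hypotheses above, $\mathbb{I}(\psi(V,p))$ is a binomial ideal (generated by the displayed binomials, which are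 computed from the reduced Gröbner basis of $\mathbb{I}(V)$).
   Context: $k$ is an algebraically closed field of characteristic zero and $\mathbb{P}^n$ is projective $n$-space over $k$. Projective varieties are Zariski closed subsets of $\mathbb{P}^n$ and need not be irreducible. For a subset $S\subseteq \mathbb{P}^n$, $\mathbb{I}(S) \subseteq k[x_0,\ldots,x_n]$ is the homogeneous ideal of polynomials vanishing on $S$; for a homogeneous ideal $I$, $\mathbb{V}(I)\subseteq\mathbb{P}^n$ is its zero locus. For ideals $I,J$ of a ring $R$, $I:J = \{f\in R \mid fJ\subseteq I\}$. For $\alpha \in \mathbb{N}^{n+1}$, $X^\alpha := x_0^{\alpha_0}\cdots x_n^{\alpha_n}$ and $p^\alpha := p_0^{\alpha_0}\cdots p_n^{\alpha_n}$ (for a fixed choice of homogeneous coordinates of $p$). A binomial is a polynomial with exactly two terms (both coefficients nonzero, distinct monomials); a binomial ideal is an ideal generated by binomials. Hadamard product: for points $p,q \in \mathbb{P}^n$, $p\star q := [p_0q_0:\cdots:p_nq_n]$, defined when $p_iq_i \neq 0$ for at least one $i$. For a point $q$ and a projective variety $V$, $q\star V$ is the Zariski closure of $\{q\star r \mid r\in V, q\star r \text{ is defined}\}$. For a projective variety $V$ and a point $p$ with no zero coordinates, $$\psi(V,p) := \{q\in\mathbb{P}^n \mid q\star V = p\star V\}.$$ *)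

theory Defs
  imports "HOL-Library.Poly_Mapping" "HOL-Computational_Algebra.Polynomial"
begin

section \<open>Polynomials\<close>

text \<open>
  The variables \<open>x\<^sub>0, \<dots>, x\<^sub>n\<close> are indexed by a finite type \<open>'n\<close>, so that \<open>CARD('n) = n + 1\<close>.
  A monomial \<open>X\<^sup>\<alpha>\<close> is identified with its exponent vector \<open>\<alpha>\<close>; the convolution product of
  \<open>Poly_Mapping\<close> is then the multiplication of polynomials.
\<close>

type_synonym 'n monomial = "'n \<Rightarrow>\<^sub>0 nat"
type_synonym ('k, 'n) mpoly = "'n monomial \<Rightarrow>\<^sub>0 'k"

definition term_poly :: "'k \<Rightarrow> 'n monomial \<Rightarrow> ('k::zero, 'n) mpoly"
  where "term_poly c \<alpha> = Poly_Mapping.single \<alpha> c"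

definition Var :: "'n \<Rightarrow> ('k::zero_neq_one, 'n) mpoly"
  where "Var i = term_poly 1 (Poly_Mapping.single i 1)"

definition eval_monomial :: "('n::finite \<Rightarrow> 'k::comm_monoid_mult) \<Rightarrow> 'n monomial \<Rightarrow> 'k"
  where "eval_monomial v \<alpha> = (\<Prod>i\<in>UNIV. v i ^ Poly_Mapping.lookup \<alpha> i)"

definition eval_poly :: "('n::finite \<Rightarrow> 'k::comm_semiring_1) \<Rightarrow> ('k, 'n) mpoly \<Rightarrow> 'k"
  where "eval_poly v f =
    (\<Sum>\<alpha>\<in>Poly_Mapping.keys f. Poly_Mapping.lookup f \<alpha> * eval_monomial v \<alpha>)"

definition monomial_degree :: "'n::finite monomial \<Rightarrow> nat"
  where "monomial_degree \<alpha> = (\<Sum>i\<in>UNIV. Poly_Mapping.lookup \<alpha> i)"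

text \<open>Total degree; the zero polynomial gets degree \<open>0\<close>.\<close>

definition total_degree :: "('k::zero, 'n::finite) mpoly \<Rightarrow> nat"
  where "total_degree f = Max (insert 0 (monomial_degree ` Poly_Mapping.keys f))"

definition homogeneous :: "('k::zero, 'n::finite) mpoly \<Rightarrow> bool"
  where "homogeneous f \<longleftrightarrow> (\<exists>d. \<forall>\<alpha>\<in>Poly_Mapping.keys f. monomial_degree \<alpha> = d)"

definition is_binomial :: "('k::zero, 'n) mpoly \<Rightarrow> bool"
  where "is_binomial f \<longleftrightarrow> card (Poly_Mapping.keys f) = 2"


section \<open>Ideals\<close>

lemma module_times: "module ((*) :: 'a::comm_ring_1 \<Rightarrow> 'a \<Rightarrow> 'a)"
  by unfold_locales (simp_all add: algebra_simps)

text \<open>The ideal generated by a set is its span in the ring as a module over itself.\<close>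

definition ideal_gen :: "'a::comm_ring_1 set \<Rightarrow> 'a set"
  where "ideal_gen B = module.span (*) B"

definition ideal_colon :: "'a::comm_ring_1 set \<Rightarrow> 'a set \<Rightarrow> 'a set"
  where "ideal_colon I J = {f. \<forall>g\<in>J. f * g \<in> I}"

definition ideal_radical :: "'a::comm_ring_1 set \<Rightarrow> 'a set"
  where "ideal_radical I = {f. \<exists>k>0. f ^ k \<in> I}"

definition binomial_ideal :: "('k::comm_ring_1, 'n) mpoly set \<Rightarrow> bool"
  where "binomial_ideal I \<longleftrightarrow> (\<exists>B. (\<forall>f\<in>B. is_binomial f) \<and> I = ideal_gen B)"


section \<open>Groebner bases\<close>

text \<open>\<open>monomial_order (\<prec>)\<close>: \<open>\<prec>\<close> is the strict part of a monomial order.\<close>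

definition monomial_order :: "('n monomial \<Rightarrow> 'n monomial \<Rightarrow> bool) \<Rightarrow> bool"
  where "monomial_order lt \<longleftrightarrow>
    irreflp lt \<and> transp lt \<and> totalp lt \<and> wfp lt \<and>
    (\<forall>\<alpha> \<beta> \<gamma>. lt \<alpha> \<beta> \<longrightarrow> lt (\<alpha> + \<gamma>) (\<beta> + \<gamma>))"

text \<open>The following three notions are meaningful for nonzero polynomials only.\<close>

definition leading_monomial ::
  "('n monomial \<Rightarrow> 'n monomial \<Rightarrow> bool) \<Rightarrow> ('k::zero, 'n) mpoly \<Rightarrow> 'n monomial"
  where "leading_monomial lt f =
    (THE \<alpha>. \<alpha> \<in> Poly_Mapping.keys f \<and> (\<forall>\<beta>\<in>Poly_Mapping.keys f. \<beta> \<noteq> \<alpha> \<longrightarrow> lt \<beta> \<alpha>))"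

definition leading_coefficient ::
  "('n monomial \<Rightarrow> 'n monomial \<Rightarrow> bool) \<Rightarrow> ('k::zero, 'n) mpoly \<Rightarrow> 'k"
  where "leading_coefficient lt f = Poly_Mapping.lookup f (leading_monomial lt f)"

definition leading_term ::
  "('n monomial \<Rightarrow> 'n monomial \<Rightarrow> bool) \<Rightarrow> ('k::zero, 'n) mpoly \<Rightarrow> ('k, 'n) mpoly"
  where "leading_term lt f = term_poly (leading_coefficient lt f) (leading_monomial lt f)"

definition groebner_basis ::
  "('n monomial \<Rightarrow> 'n monomial \<Rightarrow> bool) \<Rightarrow> ('k::comm_ring_1, 'n) mpoly set \<Rightarrow>
    ('k, 'n) mpoly set \<Rightarrow> bool"
  where "groebner_basis lt I G \<longleftrightarrow>
    finite G \<and> G \<subseteq> I \<and> 0 \<notin> G \<and>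
    ideal_gen (leading_term lt ` G) = ideal_gen (leading_term lt ` (I - {0}))"

definition reduced_groebner_basis ::
  "('n monomial \<Rightarrow> 'n monomial \<Rightarrow> bool) \<Rightarrow> ('k::comm_ring_1, 'n) mpoly set \<Rightarrow>
    ('k, 'n) mpoly set \<Rightarrow> bool"
  where "reduced_groebner_basis lt I G \<longleftrightarrow>
    groebner_basis lt I G \<and>
    (\<forall>g\<in>G. leading_coefficient lt g = 1 \<and>
      (\<forall>\<alpha>\<in>Poly_Mapping.keys g. term_poly 1 \<alpha> \<notin> ideal_gen (leading_term lt ` (G - {g}))))"


section \<open>Projective space\<close>

definition proj_rel :: "('n \<Rightarrow> 'k::field) \<Rightarrow> ('n \<Rightarrow> 'k) \<Rightarrow> bool"
  where "proj_rel u v \<longleftrightarrow> u \<noteq> (\<lambda>_. 0) \<and> (\<exists>c. c \<noteq> 0 \<and> v = (\<lambda>i. c * u i))"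

text \<open>\<open>proj_rel\<close> relates nonzero vectors only, hence the quotient is partial.\<close>

quotient_type (overloaded) ('k, 'n) proj_space = "'n \<Rightarrow> 'k::field" / partial: proj_rel
  morphisms proj_rep proj_point
proof (rule part_equivpI)
  have "proj_rel (\<lambda>_::'n. 1 :: 'k) (\<lambda>_. 1)"
    unfolding proj_rel_def by (metis mult_1 zero_neq_one)
  then show "\<exists>u :: 'n \<Rightarrow> 'k. proj_rel u u"
    by blast
  show "symp (proj_rel :: ('n \<Rightarrow> 'k) \<Rightarrow> _)"
  proof (rule sympI)
    fix u v :: "'n \<Rightarrow> 'k"
    assume "proj_rel u v"
    then obtain c where u: "u \<noteq> (\<lambda>_. 0)" and c: "c \<noteq> 0" and v: "v = (\<lambda>i. c * u i)"
      unfolding proj_rel_def by blast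
    have "u = (\<lambda>i. inverse c * v i)" "v \<noteq> (\<lambda>_. 0)"
      using u c by (auto simp: v fun_eq_iff)
    with c show "proj_rel v u"
      unfolding proj_rel_def by (metis nonzero_imp_inverse_nonzero)
  qed
  show "transp (proj_rel :: ('n \<Rightarrow> 'k) \<Rightarrow> _)"
  proof (rule transpI)
    fix u v w :: "'n \<Rightarrow> 'k"
    assume "proj_rel u v" "proj_rel v w"
    then obtain c d where "u \<noteq> (\<lambda>_. 0)" "c \<noteq> 0" "d \<noteq> 0" "w = (\<lambda>i. d * (c * u i))"
      unfolding proj_rel_def by blast
    then have "u \<noteq> (\<lambda>_. 0)" "d * c \<noteq> 0" "w = (\<lambda>i. (d * c) * u i)"
      by (auto simp: mult.assoc)
    then show "proj_rel u w"
      unfolding proj_rel_def by blast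
  qed
qed

text \<open>
  A polynomial, not necessarily homogeneous, vanishes at a point if it vanishes at all
  homogeneous coordinates of this point.
\<close>

definition vanishes_at :: "('k::field, 'n::finite) mpoly \<Rightarrow> ('k, 'n) proj_space \<Rightarrow> bool"
  where "vanishes_at f P \<longleftrightarrow>
    (\<forall>v. v \<noteq> (\<lambda>_. 0) \<and> proj_point v = P \<longrightarrow> eval_poly v f = 0)"

definition vanishing_ideal :: "('k::field, 'n::finite) proj_space set \<Rightarrow> ('k, 'n) mpoly set"
  where "vanishing_ideal S = {f. \<forall>P\<in>S. vanishes_at f P}"

definition zero_locus :: "('k::field, 'n::finite) mpoly set \<Rightarrow> ('k, 'n) proj_space set"
  where "zero_locus F = {P. \<forall>f\<in>F. vanishes_at f P}"

definition zariski_closed :: "('k::field, 'n::finite) proj_space set \<Rightarrow> bool"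
  where "zariski_closed S \<longleftrightarrow> (\<exists>F. (\<forall>f\<in>F. homogeneous f) \<and> S = zero_locus F)"

definition zariski_closure ::
  "('k::field, 'n::finite) proj_space set \<Rightarrow> ('k, 'n) proj_space set"
  where "zariski_closure S = zariski_closed hull S"


section \<open>Hadamard products\<close>

lift_definition hadamard_defined :: "('k::field, 'n) proj_space \<Rightarrow> ('k, 'n) proj_space \<Rightarrow> bool"
  is "\<lambda>u v. \<exists>i. u i * v i \<noteq> 0"
  by (auto simp: proj_rel_def)

text \<open>
  The second branch is a dummy value, returned when the product is undefined; it is never used,
  as the product below is guarded by \<open>hadamard_defined\<close>.
\<close>

lift_definition hadamard ::
  "('k::field, 'n) proj_space \<Rightarrow> ('k, 'n) proj_space \<Rightarrow> ('k, 'n) proj_space"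
  is "\<lambda>u v. if \<exists>i. u i * v i \<noteq> 0 then (\<lambda>i. u i * v i) else (\<lambda>_. 1)"
proof -
  fix u u' v v' :: "'n \<Rightarrow> 'k"
  assume "proj_rel u u'" "proj_rel v v'"
  then obtain c d where cd: "c \<noteq> 0" "d \<noteq> 0"
    and u': "u' = (\<lambda>i. c * u i)" and v': "v' = (\<lambda>i. d * v i)"
    unfolding proj_rel_def by blast
  have one: "proj_rel (\<lambda>_::'n. 1 :: 'k) (\<lambda>_. 1)"
    unfolding proj_rel_def by (metis mult_1 zero_neq_one)
  have iff: "(\<exists>i. u' i * v' i \<noteq> 0) \<longleftrightarrow> (\<exists>i. u i * v i \<noteq> 0)"
    using cd by (auto simp: u' v')
  have "proj_rel (\<lambda>i. u i * v i) (\<lambda>i. u' i * v' i)" if "\<exists>i. u i * v i \<noteq> 0"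
    unfolding proj_rel_def
  proof (intro conjI exI)
    show "(\<lambda>i. u i * v i) \<noteq> (\<lambda>_. 0)"
      using that by (metis (mono_tags))
    show "c * d \<noteq> 0" using cd by simp
    show "(\<lambda>i. u' i * v' i) = (\<lambda>i. (c * d) * (u i * v i))"
      by (auto simp: u' v' algebra_simps)
  qed
  then show "proj_rel (if \<exists>i. u i * v i \<noteq> 0 then \<lambda>i. u i * v i else (\<lambda>_. 1))
      (if \<exists>i. u' i * v' i \<noteq> 0 then \<lambda>i. u' i * v' i else (\<lambda>_. 1))"
    using one iff by auto
qed

definition hadamard_variety ::
  "('k::field, 'n::finite) proj_space \<Rightarrow> ('k, 'n) proj_space set \<Rightarrow> ('k, 'n) proj_space set"
  where "hadamard_variety q V = zariski_closure {hadamard q r | r. r \<in> V \<and> hadamard_defined q r}"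

definition psi ::
  "('k::field, 'n::finite) proj_space set \<Rightarrow> ('k, 'n) proj_space \<Rightarrow> ('k, 'n) proj_space set"
  where "psi V p = {q. hadamard_variety q V = hadamard_variety p V}"

end

theory Submission
  imports Defs
begin

text \<open>
  If \<open>q\<close> has a zero coordinate, then \<open>q \<star> V = p \<star> V\<close> would put \<open>V\<close> into a coordinate hyperplane,
  against the colon condition on \<open>V\<close>; hence \<open>\<psi>(V, p)\<close> lies in the torus. For \<open>q\<close> in the torus,
  \<open>q \<star> V\<close> is the image of \<open>V\<close> under a diagonal map, so \<open>q \<in> \<psi>(V, p)\<close> iff \<open>r = q / p\<close> stabilizes
  \<open>V\<close>. Comparing \<open>f\<^sub>i(r x)\<close> with \<open>f\<^sub>i(x)\<close> in the reduced basis, this means that all monomials of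
  every \<open>f\<^sub>i\<close> take the same value at \<open>r\<close>, that is, the binomials vanish at \<open>q\<close>. Thus \<open>\<psi>(V, p)\<close> is
  the torus part of the zero locus \<open>Z\<close> of \<open>J\<close>, and its ideal is \<open>I(Z) : \<langle>x\<^sub>0 \<cdots> x\<^sub>n\<rangle> = J\<close>.
\<close>

section \<open>Evaluation of polynomials\<close>

lemma eval_monomial_add:
  "eval_monomial v (\<alpha> + \<beta>) = eval_monomial v \<alpha> * eval_monomial v \<beta>"
  by (simp add: eval_monomial_def lookup_add power_add prod.distrib)

lemma eval_monomial_times:
  "eval_monomial (\<lambda>i. u i * v i) \<alpha> = eval_monomial u \<alpha> * eval_monomial v \<alpha>"
  by (simp add: eval_monomial_def power_mult_distrib prod.distrib)

lemma eval_monomial_inverse: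
  fixes v :: "'n::finite \<Rightarrow> 'k::field"
  shows "eval_monomial (\<lambda>i. inverse (v i)) \<alpha> = inverse (eval_monomial v \<alpha>)"
  unfolding eval_monomial_def power_inverse
  using prod_inversef[of "\<lambda>i. v i ^ Poly_Mapping.lookup \<alpha> i" UNIV] by (simp add: comp_def)

lemma eval_monomial_nonzero:
  fixes v :: "'n::finite \<Rightarrow> 'k::field"
  shows "\<forall>i. v i \<noteq> 0 \<Longrightarrow> eval_monomial v \<alpha> \<noteq> 0"
  by (simp add: eval_monomial_def)

text \<open>The support of a sum or of a rescaled polynomial may shrink; summing over one fixed
  larger set lets evaluations be compared term by term.\<close>

lemma eval_poly_superset:
  assumes "finite S" "Poly_Mapping.keys f \<subseteq> S"
  shows "eval_poly v f = (\<Sum>\<alpha>\<in>S. Poly_Mapping.lookup f \<alpha> * eval_monomial v \<alpha>)"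
  unfolding eval_poly_def
  by (rule sum.mono_neutral_left) (use assms in \<open>auto simp: in_keys_iff\<close>)

lemma eval_poly_0 [simp]: "eval_poly v 0 = 0"
  by (simp add: eval_poly_def)

lemma eval_poly_add [simp]: "eval_poly v (f + g) = eval_poly v f + eval_poly v g"
proof -
  let ?S = "Poly_Mapping.keys f \<union> Poly_Mapping.keys g"
  show ?thesis
    using Poly_Mapping.keys_add[of f g]
    by (simp add: eval_poly_superset[of ?S] lookup_add sum.distrib algebra_simps)
qed

lemma eval_poly_diff [simp]:
  fixes f g :: "('k::comm_ring_1, 'n::finite) mpoly"
  shows "eval_poly v (f - g) = eval_poly v f - eval_poly v g"
  by (metis add_diff_cancel_right' diff_add_cancel eval_poly_add)

lemma eval_poly_sum: "eval_poly v (\<Sum>x\<in>A. F x) = (\<Sum>x\<in>A. eval_poly v (F x))"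
  by (induction A rule: infinite_finite_induct) auto

lemma eval_poly_term [simp]: "eval_poly v (term_poly c \<alpha>) = c * eval_monomial v \<alpha>"
  by (simp add: eval_poly_superset[of "{\<alpha>}"] term_poly_def)

lemma term_poly_mult: "term_poly c \<alpha> * term_poly d \<beta> = term_poly (c * d) (\<alpha> + \<beta>)"
  by (simp add: term_poly_def mult_single)

text \<open>By bilinearity, this reduces statements about products to products of two single
  terms.\<close>

lemma mpoly_sum_terms:
  fixes f :: "('k::comm_monoid_add, 'n) mpoly"
  shows "f = (\<Sum>\<alpha>\<in>Poly_Mapping.keys f. term_poly (Poly_Mapping.lookup f \<alpha>) \<alpha>)"
  by (rule poly_mapping_eqI)
     (auto simp: term_poly_def lookup_sum lookup_single when_def sum.delta' in_keys_iff)

lemma eval_poly_mult [simp]: "eval_poly v (f * g) = eval_poly v f * eval_poly v g"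
proof -
  have "f * g = (\<Sum>\<alpha>\<in>Poly_Mapping.keys f. term_poly (Poly_Mapping.lookup f \<alpha>) \<alpha>) *
      (\<Sum>\<beta>\<in>Poly_Mapping.keys g. term_poly (Poly_Mapping.lookup g \<beta>) \<beta>)"
    by (rule arg_cong2[where f = "(*)", OF mpoly_sum_terms mpoly_sum_terms])
  then have "eval_poly v (f * g) = (\<Sum>\<alpha>\<in>Poly_Mapping.keys f. \<Sum>\<beta>\<in>Poly_Mapping.keys g.
      Poly_Mapping.lookup f \<alpha> * Poly_Mapping.lookup g \<beta> * (eval_monomial v \<alpha> * eval_monomial v \<beta>))"
    by (simp only: sum_product eval_poly_sum term_poly_mult eval_monomial_add eval_poly_term)
  then show ?thesis
    by (simp add: eval_poly_def sum_product ac_simps)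
qed

lemma term_poly_0_1: "term_poly 1 0 = 1"
  by (simp add: term_poly_def)

lemma eval_poly_1 [simp]: "eval_poly v 1 = 1"
  by (simp add: term_poly_0_1[symmetric] eval_monomial_def)

lemma eval_poly_power [simp]: "eval_poly v (f ^ k) = eval_poly v f ^ k"
  by (induction k) auto

lemma eval_poly_prod: "eval_poly v (\<Prod>x\<in>A. F x) = (\<Prod>x\<in>A. eval_poly v (F x))"
  by (induction A rule: infinite_finite_induct) auto

lemma eval_poly_Var [simp]: "eval_poly v (Var i) = v i"
proof -
  have "eval_monomial v (Poly_Mapping.single i 1) = (\<Prod>j\<in>UNIV. if j = i then v j else 1)"
    unfolding eval_monomial_def by (rule prod.cong) (auto simp: lookup_single when_def)
  then show ?thesis
    by (simp add: Var_def)
qed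

text \<open>This is the substitution \<open>f(r x)\<close>, the pullback of \<open>f\<close> along a
  diagonal map. The coefficientwise form makes it plain that no new monomials arise.\<close>

definition scale_poly ::
  "('n::finite \<Rightarrow> 'k) \<Rightarrow> ('k::comm_ring_1, 'n) mpoly \<Rightarrow> ('k, 'n) mpoly"
  where "scale_poly r f = Poly_Mapping.mapp (\<lambda>\<alpha> c. c * eval_monomial r \<alpha>) f"

lemma lookup_scale_poly:
  "Poly_Mapping.lookup (scale_poly r f) \<alpha> = Poly_Mapping.lookup f \<alpha> * eval_monomial r \<alpha>"
  by (auto simp: scale_poly_def lookup_mapp when_def in_keys_iff)

lemma keys_scale_poly: "Poly_Mapping.keys (scale_poly r f) \<subseteq> Poly_Mapping.keys f"
  by (simp add: scale_poly_def keys_mapp_subset)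

lemma eval_scale_poly: "eval_poly v (scale_poly r f) = eval_poly (\<lambda>i. r i * v i) f"
  unfolding eval_poly_superset[OF finite_keys keys_scale_poly]
  by (simp add: eval_poly_def lookup_scale_poly eval_monomial_times mult.assoc)

lemma homogeneous_scale_poly: "homogeneous f \<Longrightarrow> homogeneous (scale_poly r f)"
  using keys_scale_poly[of r f] unfolding homogeneous_def by blast


section \<open>Ideals and leading monomials\<close>

text \<open>Serves as the induction principle for generated ideals: \<open>S\<close> is the property
  to be established.\<close>

lemma ideal_gen_minimal:
  assumes "B \<subseteq> S" "0 \<in> S" "\<And>x y. x \<in> S \<Longrightarrow> y \<in> S \<Longrightarrow> x + y \<in> S" "\<And>c x. x \<in> S \<Longrightarrow> c * x \<in> S"
  shows "ideal_gen B \<subseteq> S"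
  unfolding ideal_gen_def using assms
  by (intro module.span_minimal[OF module_times] module.subspaceI[OF module_times]) auto

lemma ideal_gen_base: "b \<in> B \<Longrightarrow> b \<in> ideal_gen B"
  unfolding ideal_gen_def by (rule module.span_base[OF module_times])

lemma ideal_gen_mult: "x \<in> ideal_gen B \<Longrightarrow> c * x \<in> ideal_gen B"
  unfolding ideal_gen_def by (rule module.span_scale[OF module_times])

lemma eval_poly_ideal_gen_eq_0:
  assumes "\<forall>b\<in>B. eval_poly v b = 0" "f \<in> ideal_gen B"
  shows "eval_poly v f = 0"
proof -
  have "ideal_gen B \<subseteq> {f. eval_poly v f = 0}"
    by (rule ideal_gen_minimal) (use assms in auto)
  then show ?thesis
    using assms by blast
qed

section \<open>Leading monomials and division by a Groebner basis\<close>

text \<open>A finite nonempty set has a largest element for a total transitive relation, and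
  irreflexivity makes it unique; hence the definite description denotes.\<close>

lemma leading_monomial:
  assumes lt: "monomial_order lt" and "f \<noteq> 0"
  shows "leading_monomial lt f \<in> Poly_Mapping.keys f"
    and "\<And>\<beta>. \<beta> \<in> Poly_Mapping.keys f \<Longrightarrow> \<beta> \<noteq> leading_monomial lt f \<Longrightarrow> lt \<beta> (leading_monomial lt f)"
proof -
  have props: "irreflp lt" "transp lt" "totalp lt"
    using lt by (auto simp: monomial_order_def)
  have "\<exists>\<alpha>\<in>A. \<forall>\<beta>\<in>A. \<beta> \<noteq> \<alpha> \<longrightarrow> lt \<beta> \<alpha>" if "finite A" "A \<noteq> {}" for A
    using that
  proof (induction rule: finite_ne_induct)
    case (insert x A)
    then obtain \<alpha> where \<alpha>: "\<alpha> \<in> A" "\<forall>\<beta>\<in>A. \<beta> \<noteq> \<alpha> \<longrightarrow> lt \<beta> \<alpha>"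
      by blast
    have "x \<noteq> \<alpha>"
      using insert \<alpha> by blast
    then consider "lt x \<alpha>" | "lt \<alpha> x"
      using totalpD[OF props(3)] by blast
    then show ?case
    proof cases
      case 1
      with \<alpha> show ?thesis by blast
    next
      case 2
      then have "\<forall>\<beta>\<in>A. lt \<beta> x"
        using \<alpha> props(2) by (metis transpD)
      then show ?thesis by blast
    qed
  qed auto
  then obtain \<alpha> where \<alpha>: "\<alpha> \<in> Poly_Mapping.keys f \<and> (\<forall>\<beta>\<in>Poly_Mapping.keys f. \<beta> \<noteq> \<alpha> \<longrightarrow> lt \<beta> \<alpha>)"
    using \<open>f \<noteq> 0\<close> by (meson finite_keys keys_eq_empty)
  have "leading_monomial lt f = \<alpha>"
    unfolding leading_monomial_def
  proof (rule the_equality)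
    fix \<gamma> assume "\<gamma> \<in> Poly_Mapping.keys f \<and> (\<forall>\<beta>\<in>Poly_Mapping.keys f. \<beta> \<noteq> \<gamma> \<longrightarrow> lt \<beta> \<gamma>)"
    then show "\<gamma> = \<alpha>"
      using \<alpha> props by (metis irreflpD transpD)
  qed (rule \<alpha>)
  with \<alpha> show "leading_monomial lt f \<in> Poly_Mapping.keys f"
    and "\<And>\<beta>. \<beta> \<in> Poly_Mapping.keys f \<Longrightarrow> \<beta> \<noteq> leading_monomial lt f \<Longrightarrow> lt \<beta> (leading_monomial lt f)"
    by auto
qed

text \<open>If multiplication by \<open>X^\<gamma>\<close> lowered \<open>X^\<alpha>\<close>,
  repeating it would give an infinite descending chain, against well-foundedness.\<close>

lemma monomial_order_not_lt_add:
  assumes lt: "monomial_order lt"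
  shows "\<not> lt (\<alpha> + \<gamma>) \<alpha>"
proof
  assume "lt (\<alpha> + \<gamma>) \<alpha>"
  define h where "h j = ((\<lambda>\<beta>. \<beta> + \<gamma>) ^^ j) \<alpha>" for j
  have "lt (h (Suc j)) (h j)" for j
  proof (induction j)
    case (Suc j)
    then have "lt (h (Suc j) + \<gamma>) (h j + \<gamma>)"
      using lt by (auto simp: monomial_order_def)
    then show ?case by (simp add: h_def)
  qed (use \<open>lt (\<alpha> + \<gamma>) \<alpha>\<close> in \<open>simp add: h_def\<close>)
  moreover have "\<nexists>h. \<forall>j. lt (h (Suc j)) (h j)"
    using lt by (simp add: monomial_order_def wfp_def wf_iff_no_infinite_down_chain)
  ultimately show False
    by blast
qed

text \<open>The polynomials all of whose monomials are divisible by a leading monomial from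
  \<open>G\<close> form an ideal containing the leading terms. Divisibility is expressed by adding
  an exponent \<open>\<gamma>\<close>.\<close>

lemma keys_ideal_gen_leading_terms:
  fixes G :: "('k::comm_ring_1, 'n) mpoly set"
  assumes "h \<in> ideal_gen (leading_term lt ` G)" "\<alpha> \<in> Poly_Mapping.keys h"
  obtains g \<gamma> where "g \<in> G" "\<alpha> = leading_monomial lt g + \<gamma>"
proof -
  let ?S = "{h. \<forall>\<alpha>\<in>Poly_Mapping.keys h. \<exists>g\<in>G. \<exists>\<gamma>. \<alpha> = leading_monomial lt g + \<gamma>}"
  have "ideal_gen (leading_term lt ` G) \<subseteq> ?S"
  proof (rule ideal_gen_minimal)
    show "leading_term lt ` G \<subseteq> ?S"
      \<comment> \<open>The support of a leading term is the leading monomial, divisible by itself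
        with \<open>\<gamma> = 0\<close>, or is empty if the coefficient is zero.\<close>
      by (force simp: leading_term_def term_poly_def split: if_splits intro: exI[of _ 0])
    show "x + y \<in> ?S" if "x \<in> ?S" "y \<in> ?S" for x y
      using that Poly_Mapping.keys_add[of x y] by blast
    show "c * x \<in> ?S" if "x \<in> ?S" for c x
    proof safe
      fix \<alpha> assume "\<alpha> \<in> Poly_Mapping.keys (c * x)"
      then obtain \<beta> \<delta> where "\<alpha> = \<beta> + \<delta>" "\<delta> \<in> Poly_Mapping.keys x"
        using keys_mult[of c x] by blast
      moreover obtain g \<gamma> where "g \<in> G" "\<delta> = leading_monomial lt g + \<gamma>"
        using \<open>x \<in> ?S\<close> \<open>\<delta> \<in> Poly_Mapping.keys x\<close> by blast
      ultimately show "\<exists>g\<in>G. \<exists>\<gamma>. \<alpha> = leading_monomial lt g + \<gamma>"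
        by (intro bexI[of _ g] exI[of _ "\<beta> + \<gamma>"]) (auto simp: algebra_simps)
    qed
  qed simp
  with assms that show ?thesis by blast
qed

text \<open>Equality of the initial ideals puts the leading term of \<open>h\<close> into the ideal
  generated by the leading terms of \<open>G\<close>, so one of these divides it.\<close>

lemma groebner_basis_leading_monomial:
  assumes lt: "monomial_order lt" and G: "groebner_basis lt I G"
    and "h \<in> I" "h \<noteq> 0"
  obtains g \<gamma> where "g \<in> G" "leading_monomial lt h = leading_monomial lt g + \<gamma>"
proof -
  have "leading_term lt h \<in> ideal_gen (leading_term lt ` G)"
    using G \<open>h \<in> I\<close> \<open>h \<noteq> 0\<close> unfolding groebner_basis_def
    by (metis DiffI empty_iff ideal_gen_base imageI insert_iff)
  moreover have "leading_monomial lt h \<in> Poly_Mapping.keys (leading_term lt h)"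
    using leading_monomial(1)[OF lt \<open>h \<noteq> 0\<close>]
    by (simp add: leading_term_def term_poly_def leading_coefficient_def in_keys_iff)
  ultimately show ?thesis
    using that by (rule keys_ideal_gen_leading_terms)
qed

text \<open>Adding \<open>\<gamma>\<close> is injective on exponents, so a single term of
  \<open>f\<close> contributes.\<close>

lemma lookup_term_poly_mult:
  "Poly_Mapping.lookup (term_poly c \<gamma> * f) (\<gamma> + \<alpha>) = c * Poly_Mapping.lookup f \<alpha>"
  for f :: "('k::comm_ring_1, 'n) mpoly"
proof -
  have "term_poly c \<gamma> * f =
      (\<Sum>\<beta>\<in>Poly_Mapping.keys f. term_poly (c * Poly_Mapping.lookup f \<beta>) (\<gamma> + \<beta>))"
    by (subst mpoly_sum_terms[of f]) (simp add: sum_distrib_left term_poly_mult)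
  then show ?thesis
    by (auto simp: lookup_sum term_poly_def lookup_single when_def sum.delta' in_keys_iff)
qed

text \<open>Stands in for the fact that \<open>G\<close> generates \<open>I\<close>. As
  \<open>groebner_basis\<close> compares leading terms only, the division algorithm is carried out,
  by well-founded induction on the leading monomial.\<close>

lemma groebner_basis_eval_eq_0:
  fixes I :: "('k::field, 'n::finite) mpoly set"
  assumes lt: "monomial_order lt" and G: "groebner_basis lt I G"
    and I: "\<And>x y. x \<in> I \<Longrightarrow> y \<in> I \<Longrightarrow> x - y \<in> I" "\<And>c x. x \<in> I \<Longrightarrow> c * x \<in> I"
    and zero: "\<forall>g\<in>G. eval_poly v g = 0" and "h \<in> I"
  shows "eval_poly v h = 0"
proof -
  have wf: "wfp lt"
    using lt by (simp add: monomial_order_def)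
  have "\<forall>h\<in>I. h \<noteq> 0 \<longrightarrow> leading_monomial lt h = \<mu> \<longrightarrow> eval_poly v h = 0" for \<mu>
    using wf
  proof (induction \<mu> rule: wfp_induct_rule)
    case (less \<mu>)
    show ?case
    proof (intro ballI impI)
      fix h assume h: "h \<in> I" "h \<noteq> 0" "leading_monomial lt h = \<mu>"
      obtain g \<gamma> where g: "g \<in> G" "\<mu> = leading_monomial lt g + \<gamma>"
        using groebner_basis_leading_monomial[OF lt G h(1,2)] h(3) by metis
      have "g \<noteq> 0" "g \<in> I"
        using G g by (auto simp: groebner_basis_def)
      let ?lm = "leading_monomial lt g"
      \<comment> \<open>One division step: \<open>t * g\<close> has the same leading term as
        \<open>h\<close>, which therefore cancels in \<open>h'\<close>.\<close>
      define t where "t = term_poly (Poly_Mapping.lookup h \<mu> / Poly_Mapping.lookup g ?lm) \<gamma>"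
      define h' where "h' = h - t * g"
      have "h' \<in> I"
        unfolding h'_def using h \<open>g \<in> I\<close> I by blast
      have "Poly_Mapping.lookup g ?lm \<noteq> 0"
        using leading_monomial(1)[OF lt \<open>g \<noteq> 0\<close>] by (simp add: in_keys_iff)
      then have \<mu>: "\<mu> \<notin> Poly_Mapping.keys h'"
        by (simp add: h'_def t_def in_keys_iff lookup_minus g(2) lookup_term_poly_mult add.commute[of _ \<gamma>])
      \<comment> \<open>Monomials from \<open>h\<close> lie below its leading monomial
        \<open>\<mu>\<close>; those from \<open>t * g\<close> do so because the order is compatible
        with multiplication.\<close>
      have lt_\<mu>: "lt \<beta> \<mu>" if \<beta>: "\<beta> \<in> Poly_Mapping.keys h'" for \<beta>
      proof -
        have "\<beta> \<noteq> \<mu>"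
          using \<mu> \<beta> by blast
        consider "\<beta> \<in> Poly_Mapping.keys h" | "\<beta> \<in> Poly_Mapping.keys (t * g)"
          using \<beta> unfolding h'_def in_keys_iff lookup_minus by (metis diff_self)
        then show ?thesis
        proof cases
          case 1
          then show ?thesis
            using leading_monomial(2)[OF lt h(2)] h(3) \<open>\<beta> \<noteq> \<mu>\<close> by blast
        next
          case 2
          then obtain \<delta> where \<delta>: "\<beta> = \<delta> + \<gamma>" "\<delta> \<in> Poly_Mapping.keys g"
            using keys_mult[of t g] by (auto simp: t_def term_poly_def add.commute split: if_splits)
          with \<open>\<beta> \<noteq> \<mu>\<close> have "lt \<delta> ?lm"
            using leading_monomial(2)[OF lt \<open>g \<noteq> 0\<close>] g by blast
          then show ?thesis
            using lt \<delta> g by (auto simp: monomial_order_def)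
        qed
      qed
      have "eval_poly v h' = 0"
      proof (cases "h' = 0")
        case False
        then have "lt (leading_monomial lt h') \<mu>"
          using lt_\<mu> leading_monomial(1)[OF lt] by blast
        then show ?thesis
          using less.IH False \<open>h' \<in> I\<close> by blast
      qed simp
      then show "eval_poly v h = 0"
        using zero g by (simp add: h'_def)
    qed
  qed
  then show ?thesis
    using \<open>h \<in> I\<close> by (cases "h = 0") auto
qed

text \<open>Otherwise the leading monomial of \<open>h\<close> is a tail monomial of
  \<open>g\<close> divisible by the leading monomial of some \<open>g'\<close> in \<open>G\<close>.
  Here \<open>g' = g\<close> is impossible because tail monomials lie below the leading one, and any
  other \<open>g'\<close> contradicts reducedness.\<close>

lemma reduced_groebner_basis_tail_eq_0:
  fixes I :: "('k::comm_ring_1, 'n) mpoly set"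
  assumes lt: "monomial_order lt" and G: "reduced_groebner_basis lt I G" and "g \<in> G"
    and "h \<in> I" and keys: "Poly_Mapping.keys h \<subseteq> Poly_Mapping.keys g - {leading_monomial lt g}"
  shows "h = 0"
proof (rule ccontr)
  assume "h \<noteq> 0"
  have gb: "groebner_basis lt I G" and "g \<noteq> 0"
    using G \<open>g \<in> G\<close> by (auto simp: reduced_groebner_basis_def groebner_basis_def)
  define \<mu> where "\<mu> = leading_monomial lt h"
  have \<mu>: "\<mu> \<in> Poly_Mapping.keys g" "\<mu> \<noteq> leading_monomial lt g"
    using keys leading_monomial(1)[OF lt \<open>h \<noteq> 0\<close>] by (auto simp: \<mu>_def)
  obtain g' \<gamma> where g': "g' \<in> G" "\<mu> = leading_monomial lt g' + \<gamma>"
    using groebner_basis_leading_monomial[OF lt gb \<open>h \<in> I\<close> \<open>h \<noteq> 0\<close>] by (auto simp: \<mu>_def)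
  have "lt \<mu> (leading_monomial lt g)"
    using leading_monomial(2)[OF lt \<open>g \<noteq> 0\<close>] \<mu> by blast
  then have "g' \<noteq> g"
    using monomial_order_not_lt_add[OF lt] g' by metis
  then have "leading_term lt g' \<in> ideal_gen (leading_term lt ` (G - {g}))"
    using g' by (intro ideal_gen_base) auto
  then have "term_poly 1 \<gamma> * leading_term lt g' \<in> ideal_gen (leading_term lt ` (G - {g}))"
    by (rule ideal_gen_mult)
  moreover have "leading_term lt g' = term_poly 1 (leading_monomial lt g')"
    using G g' by (simp add: reduced_groebner_basis_def leading_term_def)
  ultimately have "term_poly 1 \<mu> \<in> ideal_gen (leading_term lt ` (G - {g}))"
    by (simp add: term_poly_mult g' add.commute)
  then show False
    using G \<open>g \<in> G\<close> \<mu> by (auto simp: reduced_groebner_basis_def)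
qed


section \<open>Projective space and Hadamard products\<close>

lemma torus_nonzero: "\<forall>i. v i \<noteq> 0 \<Longrightarrow> v \<noteq> (\<lambda>_. 0)"
  by auto

text \<open>\<open>proj_rel\<close> is reflexive only on vectors that represent points, and the
  lifted operations unfold only under this condition.\<close>

lemma proj_rel_refl: "v \<noteq> (\<lambda>_. 0) \<Longrightarrow> proj_rel v v"
  by (auto simp: proj_rel_def intro!: exI[of _ 1])

lemma proj_point_eq_iff:
  assumes "u \<noteq> (\<lambda>_. 0)" "v \<noteq> (\<lambda>_. 0)"
  shows "proj_point u = proj_point v \<longleftrightarrow> (\<exists>c. c \<noteq> 0 \<and> v = (\<lambda>i. c * u i))"
  using Quotient_rel[OF Quotient_proj_space, of u v] assms[THEN proj_rel_refl] assms
  by (auto simp: proj_rel_def)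

lemma proj_point_cases:
  obtains v where "v \<noteq> (\<lambda>_. 0)" "P = proj_point v"
  using Quotient_rep_reflp[OF Quotient_proj_space, of P] Quotient_abs_rep[OF Quotient_proj_space, of P]
  by (metis proj_rel_def)

lemma hadamard_defined_proj_point:
  assumes "\<forall>i. q i \<noteq> 0" "v \<noteq> (\<lambda>_. 0)"
  shows "hadamard_defined (proj_point q) (proj_point v)"
proof -
  have "q \<noteq> (\<lambda>_. 0)"
    using assms(1) by (metis)
  moreover have "\<exists>i. q i * v i \<noteq> 0"
    using assms by (auto simp: fun_eq_iff)
  ultimately show ?thesis
    by (simp add: hadamard_defined.abs_eq proj_rel_refl assms)
qed

text \<open>Definedness rules out the dummy branch of \<open>hadamard\<close> and makes the product
  vector represent a point.\<close>

lemma hadamard_proj_point: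
  assumes "q \<noteq> (\<lambda>_. 0)" "v \<noteq> (\<lambda>_. 0)" "hadamard_defined (proj_point q) (proj_point v)"
  shows "hadamard (proj_point q) (proj_point v) = proj_point (\<lambda>i. q i * v i)"
    and "(\<lambda>i. q i * v i) \<noteq> (\<lambda>_. 0)"
proof -
  have "\<exists>i. q i * v i \<noteq> 0"
    using assms by (simp add: hadamard_defined.abs_eq proj_rel_refl)
  then show "hadamard (proj_point q) (proj_point v) = proj_point (\<lambda>i. q i * v i)"
    by (simp add: hadamard.abs_eq proj_rel_refl assms)
  show "(\<lambda>i. q i * v i) \<noteq> (\<lambda>_. 0)"
    using \<open>\<exists>i. q i * v i \<noteq> 0\<close> by (auto simp: fun_eq_iff)
qed

section \<open>Vanishing ideals, zero loci and colon ideals\<close>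

lemma vanishing_ideal_iff:
  "f \<in> vanishing_ideal S \<longleftrightarrow> (\<forall>v. v \<noteq> (\<lambda>_. 0) \<and> proj_point v \<in> S \<longrightarrow> eval_poly v f = 0)"
  by (auto simp: vanishing_ideal_def vanishes_at_def)

text \<open>\<open>F\<close> may contain inhomogeneous polynomials, so every representative of the
  point has to be tested.\<close>

lemma proj_point_in_zero_locus_iff:
  assumes "v \<noteq> (\<lambda>_. 0)"
  shows "proj_point v \<in> zero_locus F \<longleftrightarrow> (\<forall>f\<in>F. \<forall>c. c \<noteq> 0 \<longrightarrow> eval_poly (\<lambda>i. c * v i) f = 0)"
proof -
  have "w \<noteq> (\<lambda>_. 0) \<and> proj_point w = proj_point v \<longleftrightarrow> (\<exists>c. c \<noteq> 0 \<and> w = (\<lambda>i. c * v i))" for w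
  proof (cases "w = (\<lambda>_. 0)")
    case False
    then show ?thesis
      using proj_point_eq_iff[OF assms False] by (simp add: eq_commute[of "proj_point w"])
  next
    case True
    with assms show ?thesis
      by (auto simp: fun_eq_iff)
  qed
  then show ?thesis
    by (auto simp: zero_locus_def vanishes_at_def)
qed

lemma vanishing_ideal_diff: "x \<in> vanishing_ideal S \<Longrightarrow> y \<in> vanishing_ideal S \<Longrightarrow> x - y \<in> vanishing_ideal S"
  and vanishing_ideal_mult: "x \<in> vanishing_ideal S \<Longrightarrow> c * x \<in> vanishing_ideal S"
  by (auto simp: vanishing_ideal_iff)

text \<open>The Galois connection between sets of polynomials and sets of points fixes every set
  that is already a zero locus.\<close>

lemma zero_locus_vanishing_ideal:
  assumes "zariski_closed V"
  shows "zero_locus (vanishing_ideal V) = V"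
proof -
  obtain F where "V = zero_locus F"
    using assms by (auto simp: zariski_closed_def)
  then show ?thesis
    by (auto simp: zero_locus_def vanishing_ideal_def)
qed

text \<open>Values lie in a field, which has no nonzero nilpotents.\<close>

lemma ideal_radical_vanishing_ideal: "ideal_radical (vanishing_ideal S) = vanishing_ideal S"
proof -
  have "f \<in> ideal_radical (vanishing_ideal S)" if "f \<in> vanishing_ideal S" for f
    using that by (auto simp: ideal_radical_def intro!: exI[of _ 1])
  then show ?thesis
    by (auto simp: ideal_radical_def vanishing_ideal_iff)
qed

text \<open>The cofactors \<open>h\<close> with \<open>f * h\<close> in \<open>I\<close> form an
  ideal, so testing the generator suffices.\<close>

lemma mem_ideal_colon_principal:
  assumes "\<And>c x. x \<in> I \<Longrightarrow> c * x \<in> I" "0 \<in> I" "\<And>x y. x \<in> I \<Longrightarrow> y \<in> I \<Longrightarrow> x + y \<in> I"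
  shows "f \<in> ideal_colon I (ideal_gen {g}) \<longleftrightarrow> f * g \<in> I"
proof
  assume "f * g \<in> I"
  then have "ideal_gen {g} \<subseteq> {h. f * h \<in> I}"
    using assms by (intro ideal_gen_minimal) (auto simp: distrib_left mult.left_commute[of f])
  then show "f \<in> ideal_colon I (ideal_gen {g})"
    by (auto simp: ideal_colon_def)
qed (simp add: ideal_colon_def ideal_gen_base)

text \<open>The product of the variables vanishes exactly off the torus, so the colon ideal is the
  ideal of the torus part of \<open>S\<close>.\<close>

lemma mem_vanishing_ideal_colon_iff:
  "f \<in> ideal_colon (vanishing_ideal S) (ideal_gen {\<Prod>i\<in>UNIV. Var i}) \<longleftrightarrow>
    (\<forall>v. (\<forall>i. v i \<noteq> 0) \<and> proj_point v \<in> S \<longrightarrow> eval_poly v f = 0)"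
proof -
  have "f \<in> ideal_colon (vanishing_ideal S) (ideal_gen {\<Prod>i\<in>UNIV. Var i}) \<longleftrightarrow>
      f * (\<Prod>i\<in>UNIV. Var i) \<in> vanishing_ideal S"
    by (rule mem_ideal_colon_principal) (auto simp: vanishing_ideal_iff)
  also have "\<dots> \<longleftrightarrow> (\<forall>v. (\<forall>i. v i \<noteq> 0) \<and> proj_point v \<in> S \<longrightarrow> eval_poly v f = 0)"
  proof -
    have "(v \<noteq> (\<lambda>_. 0) \<and> proj_point v \<in> S \<longrightarrow> eval_poly v (f * (\<Prod>i\<in>UNIV. Var i)) = 0) \<longleftrightarrow>
        ((\<forall>i. v i \<noteq> 0) \<and> proj_point v \<in> S \<longrightarrow> eval_poly v f = 0)" for v
      using torus_nonzero[of v] by (cases "\<forall>i. v i \<noteq> 0") (auto simp: eval_poly_prod)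
    then show ?thesis
      unfolding vanishing_ideal_iff by simp
  qed
  finally show ?thesis .
qed

section \<open>Hadamard products of a variety with a fixed point\<close>

text \<open>Multiplication by \<open>q\<close> is invertible, and pulling the equations of
  \<open>V\<close> back along its inverse exhibits the image of \<open>V\<close> as a zero locus.
  The closure therefore adds nothing.\<close>

lemma hadamard_variety_torus:
  assumes V: "zariski_closed V" and q: "\<forall>i. q i \<noteq> 0"
    and w: "w \<noteq> (\<lambda>_. 0)"
  shows "proj_point w \<in> hadamard_variety (proj_point q) V \<longleftrightarrow> proj_point (\<lambda>i. inverse (q i) * w i) \<in> V"
proof -
  obtain F where F: "\<forall>f\<in>F. homogeneous f" "V = zero_locus F"
    using V by (auto simp: zariski_closed_def)
  let ?q = "\<lambda>i. inverse (q i)"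
  let ?T = "zero_locus (scale_poly ?q ` F)"
  have nz: "(\<lambda>i. inverse (q i) * u i) \<noteq> (\<lambda>_. 0)" if "u \<noteq> (\<lambda>_. 0)" for u
    using q that by (auto simp: fun_eq_iff)
  have T: "proj_point u \<in> ?T \<longleftrightarrow> proj_point (\<lambda>i. inverse (q i) * u i) \<in> V" if "u \<noteq> (\<lambda>_. 0)" for u
    using that nz[OF that]
    by (simp add: proj_point_in_zero_locus_iff F(2) eval_scale_poly mult.left_commute)
  have "zariski_closed ?T"
    unfolding zariski_closed_def
    by (rule exI[of _ "scale_poly ?q ` F"]) (use F(1) in \<open>auto intro: homogeneous_scale_poly\<close>)
  moreover have "{hadamard (proj_point q) r | r. r \<in> V \<and> hadamard_defined (proj_point q) r} = ?T"
    (is "?H = _")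
  proof (intro equalityI subsetI)
    fix P assume "P \<in> ?H"
    then obtain r where r: "P = hadamard (proj_point q) r" "r \<in> V" "hadamard_defined (proj_point q) r"
      by blast
    obtain v where v: "v \<noteq> (\<lambda>_. 0)" "r = proj_point v"
      by (rule proj_point_cases)
    note h = hadamard_proj_point[OF torus_nonzero[OF q] v(1)]
    have "P = proj_point (\<lambda>i. q i * v i)" "(\<lambda>i. q i * v i) \<noteq> (\<lambda>_. 0)"
      using h r v by auto
    moreover have "(\<lambda>i. inverse (q i) * (q i * v i)) = v"
      using q by (auto simp: field_simps)
    ultimately show "P \<in> ?T"
      using T r v by simp
  next
    fix P assume "P \<in> ?T"
    obtain u where u: "u \<noteq> (\<lambda>_. 0)" "P = proj_point u"
      by (rule proj_point_cases)
    let ?v = "\<lambda>i. inverse (q i) * u i"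
    have "proj_point ?v \<in> V"
      using T u \<open>P \<in> ?T\<close> by simp
    moreover have def: "hadamard_defined (proj_point q) (proj_point ?v)"
      using hadamard_defined_proj_point[OF q nz[OF u(1)]] .
    moreover have "(\<lambda>i. q i * (inverse (q i) * u i)) = u"
      using q by (auto simp: field_simps)
    then have "P = hadamard (proj_point q) (proj_point ?v)"
      using hadamard_proj_point(1)[OF torus_nonzero[OF q] nz[OF u(1)] def] u by simp
    ultimately show "P \<in> ?H"
      by blast
  qed
  ultimately have "hadamard_variety (proj_point q) V = ?T"
    by (simp add: hadamard_variety_def zariski_closure_def hull_same)
  then show ?thesis
    using T w by simp
qed

text \<open>All the products lie in the closed hyperplane \<open>x_i = 0\<close>, hence so does
  their closure.\<close>

lemma hadamard_variety_coordinate_0: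
  assumes q: "q \<noteq> (\<lambda>_. 0)" "q i = 0" and w: "w \<noteq> (\<lambda>_. 0)"
    and "proj_point w \<in> hadamard_variety (proj_point q) V"
  shows "w i = 0"
proof -
  have "homogeneous (Var i :: ('b, 'a) mpoly)"
    by (auto simp: homogeneous_def Var_def term_poly_def)
  then have "zariski_closed (zero_locus {Var i :: ('b, 'a) mpoly})"
    unfolding zariski_closed_def by blast
  moreover have "{hadamard (proj_point q) r | r. r \<in> V \<and> hadamard_defined (proj_point q) r} \<subseteq>
      zero_locus {Var i}"
  proof clarify
    fix r assume r: "hadamard_defined (proj_point q) r"
    obtain v where v: "v \<noteq> (\<lambda>_. 0)" "r = proj_point v"
      by (rule proj_point_cases)
    show "hadamard (proj_point q) r \<in> zero_locus {Var i}"
      using hadamard_proj_point[OF q(1) v(1)] r v q(2) by (simp add: proj_point_in_zero_locus_iff)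
  qed
  ultimately have "hadamard_variety (proj_point q) V \<subseteq> zero_locus {Var i}"
    unfolding hadamard_variety_def zariski_closure_def by (intro hull_minimal)
  then have "proj_point w \<in> zero_locus {Var i}"
    using assms by blast
  then show ?thesis
    using w by (auto simp: proj_point_in_zero_locus_iff dest: spec[of _ 1])
qed

section \<open>Membership in \<open>psi\<close> and diagonal stabilizers\<close>

text \<open>This allows the ideal of \<open>psi\<close> to be tested at torus points alone.\<close>

lemma psi_torus:
  fixes V :: "('k::field, 'n::finite) proj_space set"
  assumes V: "zariski_closed V" "V \<noteq> {}"
    and V_colon: "ideal_colon (vanishing_ideal V) (ideal_gen {\<Prod>i\<in>UNIV. Var i}) = vanishing_ideal V"
    and p: "\<forall>i. p i \<noteq> 0" and q: "q \<noteq> (\<lambda>_. 0)" "proj_point q \<in> psi V (proj_point p)"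
  shows "q i \<noteq> 0"
proof
  assume "q i = 0"
  \<comment> \<open>The point with coordinates \<open>p j * v j\<close> lies in the product of
    \<open>p\<close> with \<open>V\<close>, which is that of \<open>q\<close> with \<open>V\<close>,
    so its coordinate \<open>i\<close> is zero, while \<open>p i\<close> is not.\<close>
  have "v i = 0" if "v \<noteq> (\<lambda>_. 0)" "proj_point v \<in> V" for v
  proof -
    have "(\<lambda>j. inverse (p j) * (p j * v j)) = v"
      using p by (auto simp: field_simps)
    moreover have nz: "(\<lambda>j. p j * v j) \<noteq> (\<lambda>_. 0)"
      using p that by (auto simp: fun_eq_iff)
    ultimately have "proj_point (\<lambda>j. p j * v j) \<in> hadamard_variety (proj_point q) V"
      using hadamard_variety_torus[OF V(1) p nz] q(2) that by (simp add: psi_def)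
    then have "p i * v i = 0"
      using hadamard_variety_coordinate_0[of q i, OF q(1) \<open>q i = 0\<close> nz] by simp
    then show ?thesis
      using p by simp
  qed
  \<comment> \<open>\<open>V\<close> has no torus points, so the colon ideal is the whole ring; the
    colon condition then makes 1 vanish on the nonempty set \<open>V\<close>.\<close>
  then have "1 \<in> ideal_colon (vanishing_ideal V) (ideal_gen {\<Prod>i\<in>UNIV. Var i})"
    unfolding mem_vanishing_ideal_colon_iff using torus_nonzero by metis
  then have "1 \<in> vanishing_ideal V"
    by (simp add: V_colon)
  moreover obtain v where "v \<noteq> (\<lambda>_. 0)" "proj_point v \<in> V"
    using V(2) by (metis ex_in_conv proj_point_cases)
  ultimately show False
    by (auto simp: vanishing_ideal_iff)
qed

text \<open>If \<open>r\<close> stabilizes \<open>V\<close> and \<open>\<mu>\<close> is the leading monomial of \<open>g\<close>, then \<open>g(r x) - \<mu>(r) g(x)\<close> lies in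
  the ideal of \<open>V\<close> and contains only tail monomials of \<open>g\<close>, so it vanishes by reducedness.\<close>

lemma stabilizer_iff_eval_monomial_eq:
  fixes V :: "('k::field, 'n::finite) proj_space set"
  assumes V: "zariski_closed V" and lt: "monomial_order lt"
    and G: "reduced_groebner_basis lt (vanishing_ideal V) G" and r: "\<forall>i. r i \<noteq> 0"
  shows "(\<forall>v. v \<noteq> (\<lambda>_. 0) \<and> proj_point v \<in> V \<longrightarrow> proj_point (\<lambda>i. r i * v i) \<in> V) \<longleftrightarrow>
    (\<forall>g\<in>G. \<forall>\<alpha>\<in>Poly_Mapping.keys g. eval_monomial r \<alpha> = eval_monomial r (leading_monomial lt g))"
    (is "?stab \<longleftrightarrow> ?eq")
proof
  assume ?stab
  show ?eq
  proof (intro ballI)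
    fix g \<alpha> assume g: "g \<in> G" and \<alpha>: "\<alpha> \<in> Poly_Mapping.keys g"
    let ?I = "vanishing_ideal V" and ?lm = "leading_monomial lt g"
    have "g \<in> ?I"
      using G g by (auto simp: reduced_groebner_basis_def groebner_basis_def)
    have nz: "(\<lambda>i. r i * v i) \<noteq> (\<lambda>_. 0)" if "v \<noteq> (\<lambda>_. 0)" for v
      using r that by (auto simp: fun_eq_iff)
    \<comment> \<open>\<open>term_poly c 0\<close> is the constant polynomial \<open>c\<close>; it
      is chosen to cancel the leading monomial of \<open>g\<close>.\<close>
    define h where "h = scale_poly r g - term_poly (eval_monomial r ?lm) 0 * g"
    have lookup_h: "Poly_Mapping.lookup h \<beta> =
        Poly_Mapping.lookup g \<beta> * (eval_monomial r \<beta> - eval_monomial r ?lm)" for \<beta>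
      using lookup_term_poly_mult[of "eval_monomial r ?lm" 0 g \<beta>]
      by (simp add: h_def lookup_minus lookup_scale_poly algebra_simps)
    have "scale_poly r g \<in> ?I"
      using \<open>?stab\<close> \<open>g \<in> ?I\<close> nz by (simp add: vanishing_ideal_iff eval_scale_poly)
    then have "h \<in> ?I"
      unfolding h_def using \<open>g \<in> ?I\<close> by (intro vanishing_ideal_diff vanishing_ideal_mult)
    moreover have "Poly_Mapping.keys h \<subseteq> Poly_Mapping.keys g - {?lm}"
      by (auto simp: in_keys_iff lookup_h)
    ultimately have "h = 0"
      by (rule reduced_groebner_basis_tail_eq_0[OF lt G g])
    then show "eval_monomial r \<alpha> = eval_monomial r ?lm"
      using lookup_h[of \<alpha>] \<alpha> by (simp add: in_keys_iff)
  qed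
next
  \<comment> \<open>Conversely, \<open>g(r x)\<close> is a scalar multiple of \<open>g(x)\<close>
    for every basis element, so all of them vanish at \<open>r v\<close>, and division extends this
    to the whole ideal.\<close>
  assume eq: ?eq
  show ?stab
  proof (intro allI impI, elim conjE)
    fix v assume v: "v \<noteq> (\<lambda>_. 0)" "proj_point v \<in> V"
    have nz: "(\<lambda>i. r i * v i) \<noteq> (\<lambda>_. 0)"
      using r v by (auto simp: fun_eq_iff)
    \<comment> \<open>The factor \<open>c\<close> runs through the representatives of the
      point.\<close>
    have "eval_poly (\<lambda>i. c * (r i * v i)) h = 0" if h: "h \<in> vanishing_ideal V" and c: "c \<noteq> 0" for h c
    proof (rule groebner_basis_eval_eq_0[OF lt _ vanishing_ideal_diff vanishing_ideal_mult _ h])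
      show "groebner_basis lt (vanishing_ideal V) G"
        using G by (simp add: reduced_groebner_basis_def)
      show "\<forall>g\<in>G. eval_poly (\<lambda>i. c * (r i * v i)) g = 0"
      proof
        fix g assume g: "g \<in> G"
        then have "g \<in> vanishing_ideal V"
          using G by (auto simp: reduced_groebner_basis_def groebner_basis_def)
        then have "g \<in> vanishing_ideal (zero_locus (vanishing_ideal V))"
          by (simp add: zero_locus_vanishing_ideal[OF V])
        then have "eval_poly (\<lambda>i. c * v i) g = 0"
          using v c \<open>g \<in> vanishing_ideal V\<close> proj_point_in_zero_locus_iff[OF v(1), of "vanishing_ideal V"]
          by (simp add: zero_locus_vanishing_ideal[OF V])
        moreover have "eval_poly (\<lambda>i. c * (r i * v i)) g =
            eval_monomial r (leading_monomial lt g) * eval_poly (\<lambda>i. c * v i) g"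
          unfolding eval_poly_def sum_distrib_left
        proof (rule sum.cong)
          fix \<alpha> assume "\<alpha> \<in> Poly_Mapping.keys g"
          then have "eval_monomial r (leading_monomial lt g) = eval_monomial r \<alpha>"
            using eq g by metis
          then show "Poly_Mapping.lookup g \<alpha> * eval_monomial (\<lambda>i. c * (r i * v i)) \<alpha> =
              eval_monomial r (leading_monomial lt g) *
              (Poly_Mapping.lookup g \<alpha> * eval_monomial (\<lambda>i. c * v i) \<alpha>)"
            by (simp add: eval_monomial_times)
        qed simp
        ultimately show "eval_poly (\<lambda>i. c * (r i * v i)) g = 0"
          by simp
      qed
    qed
    then have "proj_point (\<lambda>i. r i * v i) \<in> zero_locus (vanishing_ideal V)"
      by (simp add: proj_point_in_zero_locus_iff[OF nz])
    then show "proj_point (\<lambda>i. r i * v i) \<in> V"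
      by (simp add: zero_locus_vanishing_ideal[OF V])
  qed
qed

text \<open>\<open>stab r\<close> expresses only that \<open>r\<close> maps \<open>V\<close> into
  itself, so equality of the two products asks for it with \<open>r = q / p\<close> and with
  \<open>r = p / q\<close>. Cleared of denominators, both give the same monomial identities, which
  are symmetric in \<open>p\<close> and \<open>q\<close>.\<close>

lemma psi_torus_iff:
  fixes V :: "('k::field, 'n::finite) proj_space set"
  assumes V: "zariski_closed V" and lt: "monomial_order lt"
    and G: "reduced_groebner_basis lt (vanishing_ideal V) G"
    and p: "\<forall>i. p i \<noteq> 0" and q: "\<forall>i. q i \<noteq> 0"
  shows "proj_point q \<in> psi V (proj_point p) \<longleftrightarrow>
    (\<forall>g\<in>G. \<forall>\<alpha>\<in>Poly_Mapping.keys g.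
      eval_monomial q \<alpha> * eval_monomial p (leading_monomial lt g) =
      eval_monomial q (leading_monomial lt g) * eval_monomial p \<alpha>)"
proof -
  define stab where "stab r \<longleftrightarrow>
    (\<forall>v. v \<noteq> (\<lambda>_. 0) \<and> proj_point v \<in> V \<longrightarrow> proj_point (\<lambda>i. r i * v i) \<in> V)" for r
  have mono_iff: "stab (\<lambda>i. inverse (u i) * w i) \<longleftrightarrow>
      (\<forall>g\<in>G. \<forall>\<alpha>\<in>Poly_Mapping.keys g. eval_monomial w \<alpha> * eval_monomial u (leading_monomial lt g) =
      eval_monomial w (leading_monomial lt g) * eval_monomial u \<alpha>)"
    if "\<forall>i. u i \<noteq> 0" "\<forall>i. w i \<noteq> 0" for u w
  proof -
    have "\<forall>i. inverse (u i) * w i \<noteq> 0"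
      using that by simp
    note stab = stabilizer_iff_eval_monomial_eq[OF V lt G this]
    have "eval_monomial (\<lambda>i. inverse (u i) * w i) \<alpha> = eval_monomial (\<lambda>i. inverse (u i) * w i) \<beta> \<longleftrightarrow>
        eval_monomial w \<alpha> * eval_monomial u \<beta> = eval_monomial w \<beta> * eval_monomial u \<alpha>" for \<alpha> \<beta>
      using eval_monomial_nonzero[OF that(1), of \<alpha>] eval_monomial_nonzero[OF that(1), of \<beta>]
      unfolding eval_monomial_times eval_monomial_inverse by (simp add: field_simps)
    with stab show ?thesis
      by (simp only: stab_def)
  qed
  \<comment> \<open>The substitution \<open>x = w v\<close> turns stability under
    \<open>w / u\<close> into the inclusion of the product of \<open>w\<close> with \<open>V\<close>
    in that of \<open>u\<close> with \<open>V\<close>.\<close>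
  have stab_iff: "stab (\<lambda>i. inverse (u i) * w i) \<longleftrightarrow>
      (\<forall>x. x \<noteq> (\<lambda>_. 0) \<and> proj_point (\<lambda>i. inverse (w i) * x i) \<in> V \<longrightarrow> proj_point (\<lambda>i. inverse (u i) * x i) \<in> V)"
    (is "_ \<longleftrightarrow> ?R")
    if "\<forall>i. u i \<noteq> 0" "\<forall>i. w i \<noteq> 0" for u w
  proof
    assume s: "stab (\<lambda>i. inverse (u i) * w i)"
    show ?R
    proof (intro allI impI, elim conjE)
      fix x assume x: "x \<noteq> (\<lambda>_. 0)" "proj_point (\<lambda>i. inverse (w i) * x i) \<in> V"
      have "(\<lambda>i. inverse (w i) * x i) \<noteq> (\<lambda>_. 0)"
        using x that by (auto simp: fun_eq_iff)
      then have "proj_point (\<lambda>i. inverse (u i) * w i * (inverse (w i) * x i)) \<in> V"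
        using s x(2) by (simp add: stab_def)
      moreover have "(\<lambda>i. inverse (u i) * w i * (inverse (w i) * x i)) = (\<lambda>i. inverse (u i) * x i)"
        using that by (auto simp: field_simps)
      ultimately show "proj_point (\<lambda>i. inverse (u i) * x i) \<in> V"
        by simp
    qed
  next
    assume R: ?R
    show "stab (\<lambda>i. inverse (u i) * w i)"
      unfolding stab_def
    proof (intro allI impI, elim conjE)
      fix v assume v: "v \<noteq> (\<lambda>_. 0)" "proj_point v \<in> V"
      have "(\<lambda>i. w i * v i) \<noteq> (\<lambda>_. 0)"
        using v that by (auto simp: fun_eq_iff)
      moreover have "(\<lambda>i. inverse (w i) * (w i * v i)) = v"
        using that by (auto simp: field_simps)
      ultimately show "proj_point (\<lambda>i. inverse (u i) * w i * v i) \<in> V"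
        using R[rule_format, of "\<lambda>i. w i * v i"] v by (simp add: mult.assoc)
    qed
  qed
  have "proj_point q \<in> psi V (proj_point p) \<longleftrightarrow>
      (\<forall>P. P \<in> hadamard_variety (proj_point q) V \<longleftrightarrow> P \<in> hadamard_variety (proj_point p) V)"
    by (auto simp: psi_def)
  also have "\<dots> \<longleftrightarrow> (\<forall>x. x \<noteq> (\<lambda>_. 0) \<longrightarrow>
      (proj_point (\<lambda>i. inverse (q i) * x i) \<in> V \<longleftrightarrow> proj_point (\<lambda>i. inverse (p i) * x i) \<in> V))"
  proof -
    have "(\<forall>P. Q P) \<longleftrightarrow> (\<forall>x. x \<noteq> (\<lambda>_. 0) \<longrightarrow> Q (proj_point x))" for Q :: "('k, 'n) proj_space \<Rightarrow> bool"
      by (metis proj_point_cases)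
    then show ?thesis
      by (simp add: hadamard_variety_torus[OF V p] hadamard_variety_torus[OF V q])
  qed
  also have "\<dots> \<longleftrightarrow> stab (\<lambda>i. inverse (p i) * q i) \<and> stab (\<lambda>i. inverse (q i) * p i)"
    unfolding stab_iff[OF p q] stab_iff[OF q p] by blast
  also have "\<dots> \<longleftrightarrow> (\<forall>g\<in>G. \<forall>\<alpha>\<in>Poly_Mapping.keys g.
      eval_monomial q \<alpha> * eval_monomial p (leading_monomial lt g) =
      eval_monomial q (leading_monomial lt g) * eval_monomial p \<alpha>)"
    unfolding mono_iff[OF p q] mono_iff[OF q p]
    by (auto simp: mult.commute[of "eval_monomial p _"])
  finally show ?thesis .
qed

theorem theorem5p3:
  fixes V :: "('k::{alg_closed_field, field_char_0}, 'n::finite) proj_space set"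
    and p :: "'n \<Rightarrow> 'k"
    and lt :: "'n monomial \<Rightarrow> 'n monomial \<Rightarrow> bool"
    and m :: nat
    and f :: "nat \<Rightarrow> ('k, 'n) mpoly"
    and k :: "nat \<Rightarrow> nat"
    and \<alpha> :: "nat \<Rightarrow> nat \<Rightarrow> 'n monomial"
    and a b :: "nat \<Rightarrow> nat \<Rightarrow> 'k"
    and B J :: "('k, 'n) mpoly set"
  assumes V: "zariski_closed V" "V \<noteq> {}"
    and V_colon: "ideal_colon (vanishing_ideal V) (ideal_gen {\<Prod>i\<in>UNIV. Var i}) = vanishing_ideal V"
    and p: "\<forall>i. p i \<noteq> 0"
    and lt: "monomial_order lt"
    and G: "inj_on f {1..m}" "reduced_groebner_basis lt (vanishing_ideal V) (f ` {1..m})"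
    and deg: "\<forall>i\<in>{1..m}. 2 \<le> total_degree (f i)"
    and k: "\<forall>i\<in>{1..m}. 1 \<le> k i"
    and f: "\<forall>i\<in>{1..m}. f i = term_poly 1 (\<alpha> 1 i) - (\<Sum>l\<in>{2..k i}. term_poly (a l i) (\<alpha> l i))"
    and a: "\<forall>i\<in>{1..m}. \<forall>l\<in>{2..k i}. a l i \<noteq> 0"
    and \<alpha>: "\<forall>i\<in>{1..m}. \<forall>l l'. 1 \<le> l \<and> l < l' \<and> l' \<le> k i \<longrightarrow> lt (\<alpha> l' i) (\<alpha> l i)"
    and b: "\<forall>i\<in>{1..m}. \<forall>l\<in>{1..k i}. b l i \<noteq> 0"
    and bp: "\<forall>i\<in>{1..m}. \<forall>l\<in>{2..k i}.
      b 1 i * eval_monomial p (\<alpha> 1 i) = b l i * eval_monomial p (\<alpha> l i)"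
    and B: "B = {term_poly (b 1 i) (\<alpha> 1 i) - term_poly (b l i) (\<alpha> l i) | i l.
      i \<in> {1..m} \<and> l \<in> {2..k i}}"
    and J: "J = ideal_gen B"
    and J_colon: "ideal_colon (vanishing_ideal (zero_locus J)) (ideal_gen {\<Prod>i\<in>UNIV. Var i}) = J"
  shows "J = ideal_radical J
    \<and> ideal_radical J = vanishing_ideal (psi V (proj_point p))
    \<and> binomial_ideal (vanishing_ideal (psi V (proj_point p)))
    \<and> (\<forall>g\<in>B. is_binomial g) \<and> vanishing_ideal (psi V (proj_point p)) = ideal_gen B"
proof -
  let ?psi = "psi V (proj_point p)" and ?lc = "leading_monomial lt"

  \<comment> \<open>Supports and leading monomials of the basis elements\<close>
  have terms: "Poly_Mapping.lookup (f i) \<beta> =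
      (1 when \<alpha> 1 i = \<beta>) - (\<Sum>l\<in>{2..k i}. a l i when \<alpha> l i = \<beta>)" if "i \<in> {1..m}" for i \<beta>
    using f that by (simp add: lookup_minus lookup_sum term_poly_def lookup_single)
  have lt_irrefl: "\<not> lt \<beta> \<beta>" for \<beta>
    using lt by (auto simp: monomial_order_def dest: irreflpD)
  have \<alpha>_lt: "lt (\<alpha> l i) (\<alpha> 1 i)" if "i \<in> {1..m}" "l \<in> {2..k i}" for i l
    using \<alpha> that by simp
  \<comment> \<open>Strictly decreasing monomials are distinct, so nothing cancels in the displayed
    form of \<open>f i\<close> and its support can be read off.\<close>
  have \<alpha>_inj: "\<alpha> l i \<noteq> \<alpha> l' i" if "i \<in> {1..m}" "1 \<le> l" "l < l'" "l' \<le> k i" for i l l'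
    using \<alpha> that lt_irrefl by metis
  have lookup_tail: "Poly_Mapping.lookup (f i) (\<alpha> l i) = - a l i"
    if i: "i \<in> {1..m}" and l: "l \<in> {2..k i}" for i l
  proof -
    have "\<alpha> 1 i \<noteq> \<alpha> l i"
      using \<alpha>_inj[of i 1 l] i l by simp
    moreover have "(\<Sum>l'\<in>{2..k i}. a l' i when \<alpha> l' i = \<alpha> l i) = (\<Sum>l'\<in>{2..k i}. if l' = l then a l' i else 0)"
    proof (rule sum.cong)
      fix l' assume "l' \<in> {2..k i}"
      then have "\<alpha> l' i = \<alpha> l i \<longleftrightarrow> l' = l"
        using \<alpha>_inj[of i l l'] \<alpha>_inj[of i l' l] i l by (metis atLeastAtMost_iff linorder_neqE_nat one_le_numeral order_trans)
      then show "(a l' i when \<alpha> l' i = \<alpha> l i) = (if l' = l then a l' i else 0)"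
        by simp
    qed simp
    ultimately show ?thesis
      using l by (simp add: terms[OF i])
  qed
  have lookup_head: "Poly_Mapping.lookup (f i) (\<alpha> 1 i) = 1" if i: "i \<in> {1..m}" for i
  proof -
    have "(\<Sum>l\<in>{2..k i}. a l i when \<alpha> l i = \<alpha> 1 i) = 0"
    proof (intro sum.neutral ballI)
      fix l assume "l \<in> {2..k i}"
      then show "(a l i when \<alpha> l i = \<alpha> 1 i) = 0"
        using \<alpha>_inj[OF i, of 1 l] by simp
    qed
    then show ?thesis
      by (simp add: terms[OF i])
  qed
  have keys: "Poly_Mapping.keys (f i) = insert (\<alpha> 1 i) ((\<lambda>l. \<alpha> l i) ` {2..k i})" if i: "i \<in> {1..m}" for i
  proof
    show "Poly_Mapping.keys (f i) \<subseteq> insert (\<alpha> 1 i) ((\<lambda>l. \<alpha> l i) ` {2..k i})"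
    proof
      fix \<beta> assume "\<beta> \<in> Poly_Mapping.keys (f i)"
      moreover have "Poly_Mapping.lookup (f i) \<beta> = 0" if "\<beta> \<notin> insert (\<alpha> 1 i) ((\<lambda>l. \<alpha> l i) ` {2..k i})"
        using that by (auto simp: terms[OF i] when_def intro!: sum.neutral)
      ultimately show "\<beta> \<in> insert (\<alpha> 1 i) ((\<lambda>l. \<alpha> l i) ` {2..k i})"
        by (auto simp: in_keys_iff)
    qed
    show "insert (\<alpha> 1 i) ((\<lambda>l. \<alpha> l i) ` {2..k i}) \<subseteq> Poly_Mapping.keys (f i)"
      using a i lookup_head lookup_tail by (auto simp: in_keys_iff)
  qed
  have lm: "leading_monomial lt (f i) = \<alpha> 1 i" if i: "i \<in> {1..m}" for i
  proof (rule ccontr)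
    assume ne: "leading_monomial lt (f i) \<noteq> \<alpha> 1 i"
    have "f i \<noteq> 0"
      using lookup_head[OF i] by auto
    note L = leading_monomial[OF lt this]
    have "lt (\<alpha> 1 i) (leading_monomial lt (f i))"
      using L(2)[of "\<alpha> 1 i"] ne keys[OF i] by auto
    moreover have "lt (leading_monomial lt (f i)) (\<alpha> 1 i)"
      using L(1) ne keys[OF i] \<alpha>_lt[OF i] by auto
    ultimately show False
      using lt lt_irrefl by (metis monomial_order_def transpD)
  qed

  \<comment> \<open>Comparison of \<open>J\<close> with \<open>psi\<close> at torus points\<close>
  have psi_iff: "proj_point q \<in> ?psi \<longleftrightarrow> (\<forall>g\<in>B. eval_poly q g = 0)" if q: "\<forall>i. q i \<noteq> 0" for q
  proof -
    \<comment> \<open>Eliminating \<open>b l i\<close> by means of \<open>bp\<close> turns the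
      vanishing of a binomial at \<open>q\<close> into an identity between monomials in
      \<open>p\<close> and \<open>q\<close>.\<close>
    have "b 1 i * eval_monomial q (\<alpha> 1 i) = b l i * eval_monomial q (\<alpha> l i) \<longleftrightarrow>
        eval_monomial q (\<alpha> l i) * eval_monomial p (\<alpha> 1 i) =
        eval_monomial q (\<alpha> 1 i) * eval_monomial p (\<alpha> l i)"
      if il: "i \<in> {1..m}" "l \<in> {2..k i}" for i l
    proof -
      have "b 1 i * eval_monomial p (\<alpha> 1 i) = b l i * eval_monomial p (\<alpha> l i)"
        using bp il by blast
      moreover have "b 1 i \<noteq> 0" "eval_monomial p (\<alpha> l i) \<noteq> 0"
        using b il eval_monomial_nonzero[OF p] by auto
      ultimately have b1: "b l i = b 1 i * eval_monomial p (\<alpha> 1 i) / eval_monomial p (\<alpha> l i)"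
        by (simp add: field_simps)
      show ?thesis
        using \<open>b 1 i \<noteq> 0\<close> \<open>eval_monomial p (\<alpha> l i) \<noteq> 0\<close> unfolding b1 by (auto simp: field_simps)
    qed
    then have "(\<forall>g\<in>B. eval_poly q g = 0) \<longleftrightarrow> (\<forall>i\<in>{1..m}. \<forall>l\<in>{2..k i}.
        eval_monomial q (\<alpha> l i) * eval_monomial p (\<alpha> 1 i) =
        eval_monomial q (\<alpha> 1 i) * eval_monomial p (\<alpha> l i))"
      unfolding B by fastforce
    \<comment> \<open>The monomial with index 1 is the leading one and gives a trivial identity, so
      the indices from 2 on suffice.\<close>
    also have "\<dots> \<longleftrightarrow> proj_point q \<in> ?psi"
      by (simp add: psi_torus_iff[OF V(1) lt G(2) p q] keys lm del: One_nat_def)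
    finally show ?thesis ..
  qed
  \<comment> \<open>The zero locus tests every multiple \<open>c v\<close>, whereas
    \<open>psi_iff\<close> speaks of one representative. Membership in \<open>psi\<close> does not
    depend on the representative, so \<open>psi_iff\<close> applies to all of them.\<close>
  have zero_locus_iff: "proj_point v \<in> zero_locus J \<longleftrightarrow> proj_point v \<in> ?psi" if v: "\<forall>i. v i \<noteq> 0" for v
  proof -
    have "proj_point (\<lambda>i. c * v i) = proj_point v" "\<forall>i. c * v i \<noteq> 0" if "c \<noteq> 0" for c
    proof -
      show "\<forall>i. c * v i \<noteq> 0"
        using v that by simp
      from torus_nonzero[OF this] show "proj_point (\<lambda>i. c * v i) = proj_point v"
        using proj_point_eq_iff[OF torus_nonzero[OF v], of "\<lambda>i. c * v i"] that by auto
    qed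
    then have "proj_point v \<in> ?psi \<longleftrightarrow> (\<forall>c. c \<noteq> 0 \<longrightarrow> (\<forall>g\<in>B. eval_poly (\<lambda>i. c * v i) g = 0))"
      using psi_iff by (metis zero_neq_one)
    also have "\<dots> \<longleftrightarrow> (\<forall>c. c \<noteq> 0 \<longrightarrow> (\<forall>g\<in>J. eval_poly (\<lambda>i. c * v i) g = 0))"
      unfolding J by (metis eval_poly_ideal_gen_eq_0 ideal_gen_base)
    finally show ?thesis
      using proj_point_in_zero_locus_iff[OF torus_nonzero[OF v]] by auto
  qed
  \<comment> \<open>By \<open>J_colon\<close>, \<open>J\<close> is the ideal of the torus part of
    its zero locus. This is the torus part of \<open>psi\<close>, and by \<open>psi_torus\<close>
    all of \<open>psi\<close>.\<close>
  have "g \<in> J \<longleftrightarrow> g \<in> vanishing_ideal ?psi" for g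
  proof -
    have "g \<in> J \<longleftrightarrow>
        g \<in> ideal_colon (vanishing_ideal (zero_locus J)) (ideal_gen {\<Prod>i\<in>UNIV. Var i})"
      by (simp only: J_colon)
    also have "\<dots> \<longleftrightarrow> (\<forall>v. (\<forall>i. v i \<noteq> 0) \<and> proj_point v \<in> ?psi \<longrightarrow> eval_poly v g = 0)"
      unfolding mem_vanishing_ideal_colon_iff using zero_locus_iff by auto
    also have "\<dots> \<longleftrightarrow> g \<in> vanishing_ideal ?psi"
      unfolding vanishing_ideal_iff using psi_torus[OF V V_colon p] torus_nonzero by metis
    finally show ?thesis .
  qed
  then have J_psi: "J = vanishing_ideal ?psi"
    by blast
  have "is_binomial g" if g_B: "g \<in> B" for g
  proof -
    obtain i l where il: "i \<in> {1..m}" "l \<in> {2..k i}"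
      and g: "g = term_poly (b 1 i) (\<alpha> 1 i) - term_poly (b l i) (\<alpha> l i)"
      using g_B unfolding B by blast
    have "b 1 i \<noteq> 0" "b l i \<noteq> 0" "\<alpha> 1 i \<noteq> \<alpha> l i"
      using b il \<alpha>_inj[of i 1 l] by auto
    then have "Poly_Mapping.keys g = {\<alpha> 1 i, \<alpha> l i}"
      by (auto simp: g in_keys_iff lookup_minus term_poly_def lookup_single when_def split: if_splits)
    then show ?thesis
      using \<open>\<alpha> 1 i \<noteq> \<alpha> l i\<close> by (simp add: is_binomial_def)
  qed
  moreover have "ideal_radical J = J"
    unfolding J_psi by (rule ideal_radical_vanishing_ideal)
  ultimately show ?thesis
    using J J_psi unfolding binomial_ideal_def by metis
qed

end
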